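(* Let $(\mathcal{A},\cdot)$ be a flexible algebra over a field $\mathbb{F}$ of characteristic $\neq 2$, and let $R:\mathcal{A}\to\mathcal{A}$ be a linear map such that $R\circ R=R$ (composition of maps) and $$R(x)\cdot R(y)=R(R(x)\cdot y)=R(x\cdot y)\quad\text{for all }x,y\in\mathcal{A}.$$ Then the product $x\ast y=R(x\cdot y)$ defines a new flexible algebra structure on $\mathcal{A}$.
   Context: A flexible algebra is a vector space $\mathcal{J}$ over a field $\mathbb{F}$ of characteristic $\neq 2$ with a (bilinear, not necessarily associative) binary operation $\ast$ satisfying $(x\ast y)\ast x=x\ast(y\ast x)$ for all $x,y\in\mathcal{J}$. *)

theory Defs
  imports "HOL-Computational_Algebra.Computational_Algebra"
begin

locale flexible_algebra = vector_space scale
  for scale :: "'f::field \<Rightarrow> 'v::ab_group_add \<Rightarrow> 'v" +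
  fixes mult :: "'v \<Rightarrow> 'v \<Rightarrow> 'v"
  assumes char_neq_2: "CHAR('f) \<noteq> 2"
    and linear_left: "Vector_Spaces.linear scale scale (\<lambda>x. mult x y)"
    and linear_right: "Vector_Spaces.linear scale scale (\<lambda>y. mult x y)"
    and flexible: "mult (mult x y) x = mult x (mult y x)"

end

theory Submission
  imports Defs
begin

text \<open>
  The hypotheses make \<open>R\<close> transparent inside an outer \<open>R\<close>: a factor of a product may be
  replaced by its image under \<open>R\<close> without changing the image of the product. For the left
  factor this is assumed; for the right factor it follows from idempotency. Erasing all
  inner occurrences of \<open>R\<close> turns the flexible law for the new product into the image
  under \<open>R\<close> of the flexible law of the original one.
\<close>

text \<open>
  Both sides equal \<open>mult (R x) (R y)\<close>: this product is unchanged when its right factor is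
  projected once more, so reading the averaging identity at \<open>R y\<close> instead of \<open>y\<close> gives
  the same value.
\<close>

lemma averaging_absorbs_right:
  fixes mult :: "'v \<Rightarrow> 'v \<Rightarrow> 'v" and R :: "'v \<Rightarrow> 'v"
  assumes idem: "R \<circ> R = R"
    and avg: "\<And>x y. mult (R x) (R y) = R (mult (R x) y)"
    and absorb_left: "\<And>x y. R (mult (R x) y) = R (mult x y)"
  shows "R (mult x (R y)) = R (mult x y)"
proof -
  have idem': "R (R z) = R z" for z
    using idem by (metis comp_apply)
  have "R (mult x (R y)) = mult (R x) (R (R y))"
    by (simp only: avg[of x "R y"] absorb_left)
  also have "\<dots> = R (mult x y)"
    by (simp only: idem' avg absorb_left)
  finally show ?thesis .
qed

theorem proposition6p0p3:
  fixes scale :: "'f::field \<Rightarrow> 'v::ab_group_add \<Rightarrow> 'v"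
    and mult :: "'v \<Rightarrow> 'v \<Rightarrow> 'v"
    and R :: "'v \<Rightarrow> 'v"
  assumes "flexible_algebra scale mult"
    and "Vector_Spaces.linear scale scale R"
    and "R \<circ> R = R"
    and "\<And>x y. mult (R x) (R y) = R (mult (R x) y)"
    and "\<And>x y. R (mult (R x) y) = R (mult x y)"
  shows "flexible_algebra scale (\<lambda>x y. R (mult x y))"
proof -
  interpret A: flexible_algebra scale mult by (fact assms(1))
  note absorb_right = averaging_absorbs_right[of R mult, OF assms(3-5)]
  show ?thesis
  proof (intro flexible_algebra.intro flexible_algebra_axioms.intro)
    show "vector_space scale"
      by (fact A.vector_space_axioms)
    show "CHAR('f) \<noteq> 2"
      by (fact A.char_neq_2)
    show "Vector_Spaces.linear scale scale (\<lambda>x. R (mult x y))" for y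
      using Vector_Spaces.linear_compose[OF A.linear_left assms(2)] by (simp add: comp_def)
    show "Vector_Spaces.linear scale scale (\<lambda>y. R (mult x y))" for x
      using Vector_Spaces.linear_compose[OF A.linear_right assms(2)] by (simp add: comp_def)
    show "R (mult (R (mult x y)) x) = R (mult x (R (mult y x)))" for x y
      by (simp only: assms(5) absorb_right A.flexible)
  qed
qed

end
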